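(* Let $m\ge n\ge2$ be integers. The number of $n\times m$ Ferrers diagrams $\mathcal{F}$ for which the pair $(\mathcal{F},2)$ is MDS-constructible is $$\frac{m-n+1}{m}\binom{m+n-2}{n-1}.$$ In particular, the number of $n\times n$ Ferrers diagrams $\mathcal{F}$ for which $(\mathcal{F},2)$ is MDS-constructible is the $(n-1)$-th Catalan number $\frac{1}{n}\binom{2n-2}{n-1}$.
   Context: $[i]=\{1,\dots,i\}$. An $n\times m$ Ferrers diagram is a subset $\mathcal{F}\subseteq[n]\times[m]$ such that $(1,1),(n,m)\in\mathcal{F}$; if $(i,j)\in\mathcal{F}$ and $j<m$ then $(i,j+1)\in\mathcal{F}$; and if $(i,j)\in\mathcal{F}$ and $i>1$ then $(i-1,j)\in\mathcal{F}$. Let $c_j=|\{i:(i,j)\in\mathcal{F}\}|$. For $1\le d\le\min\{n,m\}$ and $0\le j\le d-1$ set $\kappa_j(\mathcal{F},d)=\sum_{t=1}^{m-d+1+j}\max\{c_t-j,0\}$ and $\kappa(\mathcal{F},d)=\min_j\kappa_j(\mathcal{F},d)$. For $1\le i\le m+n-1$, $D_i=\{(a,b)\in[n]\times[m]: b-a=m-i\}$. The pair $(\mathcal{F},d)$ is MDS-constructible if $\kappa(\mathcal{F},d)=\sum_{i=1}^{m+n-1}\max\{0,|D_i\cap\mathcal{F}|-d+1\}$. *)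

theory Defs
  imports Complex_Main
begin

definition ferrers_diagram :: "nat \<Rightarrow> nat \<Rightarrow> (nat \<times> nat) set \<Rightarrow> bool" where
  "ferrers_diagram n m F \<longleftrightarrow>
     F \<subseteq> {1..n} \<times> {1..m} \<and>
     (1, 1) \<in> F \<and> (n, m) \<in> F \<and>
     (\<forall>i j. (i, j) \<in> F \<and> j < m \<longrightarrow> (i, j + 1) \<in> F) \<and>
     (\<forall>i j. (i, j) \<in> F \<and> i > 1 \<longrightarrow> (i - 1, j) \<in> F)"

definition col_card :: "(nat \<times> nat) set \<Rightarrow> nat \<Rightarrow> nat" where
  "col_card F j = card {i. (i, j) \<in> F}"

text \<open>
  The parameter d is meant to satisfy 1 \<le> d \<le> min n m; in that range the truncated
  subtraction m - d and the minimum over j < d below are as usual. The summands are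
  integers, so that their subtractions do not truncate.
\<close>

definition kappa_j :: "nat \<Rightarrow> (nat \<times> nat) set \<Rightarrow> nat \<Rightarrow> nat \<Rightarrow> int" where
  "kappa_j m F d j = (\<Sum>t = 1..m - d + 1 + j. max (int (col_card F t) - int j) 0)"

definition kappa :: "nat \<Rightarrow> (nat \<times> nat) set \<Rightarrow> nat \<Rightarrow> int" where
  "kappa m F d = Min ((\<lambda>j. kappa_j m F d j) ` {..<d})"

definition diagonal :: "nat \<Rightarrow> nat \<Rightarrow> nat \<Rightarrow> (nat \<times> nat) set" where
  "diagonal n m i = {(a, b). a \<in> {1..n} \<and> b \<in> {1..m} \<and> int b - int a = int m - int i}"

definition MDS_constructible :: "nat \<Rightarrow> nat \<Rightarrow> (nat \<times> nat) set \<Rightarrow> nat \<Rightarrow> bool" where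
  "MDS_constructible n m F d \<longleftrightarrow>
     kappa m F d = (\<Sum>i = 1..m + n - 1. max 0 (int (card (diagonal n m i \<inter> F)) - int d + 1))"

definition catalan :: "nat \<Rightarrow> real" where
  "catalan k = real ((2 * k) choose k) / real (k + 1)"

end

theory Submission
  imports Defs
begin

text \<open>
  Since \<open>m \<ge> n\<close>, the minimum \<open>\<kappa>(F,2)\<close> is \<open>|F| - m\<close>, while the diagonal sum is \<open>|F|\<close> minus the
  number of diagonals meeting \<open>F\<close>. The first row already meets the \<open>m\<close> diagonals \<open>b - a \<ge> 0\<close>, so
  the pair is constructible exactly when \<open>F\<close> lies weakly above the main diagonal. Such diagrams
  satisfy the ballot recurrence, according to whether \<open>(n, m - 1) \<in> F\<close> (delete the last column) or
  not (delete the corner \<open>(n, m)\<close>, the only cell of the last row).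
\<close>

text \<open>No relation between \<open>n\<close> and \<open>m\<close> is imposed, so the recurrence
  may reach the boundary \<open>m < n\<close>, where the set is empty.\<close>

definition upper_ferrers :: "nat \<Rightarrow> nat \<Rightarrow> (nat \<times> nat) set set" where
  "upper_ferrers n m = {F. ferrers_diagram n m F \<and> (\<forall>(a, b) \<in> F. a \<le> b)}"

section \<open>Constructibility\<close>

lemma ferrers_finite:
  assumes "ferrers_diagram n m F"
  shows "finite F"
  using assms finite_subset[of F "{1..n} \<times> {1..m}"] by (auto simp: ferrers_diagram_def)

lemma ferrers_bounds:
  assumes "ferrers_diagram n m F" "(a, b) \<in> F"
  shows "1 \<le> a" "a \<le> n" "1 \<le> b" "b \<le> m"
  using assms by (auto simp: ferrers_diagram_def)

lemma ferrers_right: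
  assumes "ferrers_diagram n m F" "(a, b) \<in> F" "b \<le> b'" "b' \<le> m"
  shows "(a, b') \<in> F"
  using assms(3,4)
proof (induction b' rule: dec_induct)
  case base
  show ?case by (rule assms(2))
next
  case (step k)
  then show ?case using assms(1) by (auto simp: ferrers_diagram_def)
qed

lemma ferrers_up:
  assumes "ferrers_diagram n m F" "(a, b) \<in> F" "a' \<le> a" "1 \<le> a'"
  shows "(a', b) \<in> F"
  using assms(3,4)
proof (induction a' rule: inc_induct)
  case base
  show ?case by (rule assms(2))
next
  case (step k)
  then have "(Suc k, b) \<in> F" "k \<ge> 1" by auto
  then show ?case using assms(1) unfolding ferrers_diagram_def
    by (metis One_nat_def diff_Suc_1 less_Suc_eq_le)
qed

lemma ferrers_first_row:
  assumes "ferrers_diagram n m F" "1 \<le> b" "b \<le> m"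
  shows "(1, b) \<in> F"
  using ferrers_right[OF assms(1) _ assms(2,3)] assms(1) by (auto simp: ferrers_diagram_def)

lemma ferrers_last_column:
  assumes "ferrers_diagram n m F"
  shows "(a, m) \<in> F \<longleftrightarrow> 1 \<le> a \<and> a \<le> n"
proof -
  have "(n, m) \<in> F" using assms by (simp add: ferrers_diagram_def)
  then show ?thesis using ferrers_up[OF assms] ferrers_bounds[OF assms] by blast
qed

section \<open>The two sides of the constructibility equation\<close>

lemma card_eq_sum_col_card:
  assumes "ferrers_diagram n m F"
  shows "card F = (\<Sum>t = 1..m. col_card F t)"
proof -
  have "(\<Sum>t = 1..m. col_card F t) = (\<Sum>t \<in> {1..m}. card {p \<in> F. snd p = t})"
  proof (rule sum.cong[OF refl])
    fix t
    have "{p \<in> F. snd p = t} = (\<lambda>i. (i, t)) ` {i. (i, t) \<in> F}" by force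
    then show "col_card F t = card {p \<in> F. snd p = t}"
      by (simp add: col_card_def card_image inj_on_def)
  qed
  also have "\<dots> = card (\<Union>t \<in> {1..m}. {p \<in> F. snd p = t})"
    by (rule card_UN_disjoint[symmetric]) (use ferrers_finite[OF assms] in auto)
  also have "(\<Union>t \<in> {1..m}. {p \<in> F. snd p = t}) = F"
    using ferrers_bounds[OF assms] by fastforce
  finally show ?thesis by simp
qed

text \<open>For \<open>j = 0\<close> the sum omits the last column, which is full and has
  \<open>n\<close> cells; for \<open>j = 1\<close> it removes one cell from each of the
  \<open>m\<close> columns. As \<open>n \<le> m\<close>, the second value is the minimum.\<close>

lemma kappa_two:
  assumes "ferrers_diagram n m F" "n \<le> m" "2 \<le> m"
  shows "kappa m F 2 = int (card F) - int m"
proof -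
  \<comment> \<open>Every column contains its first-row cell, so the truncation at 0 never acts for
    \<open>j = 1\<close>.\<close>
  have colpos: "col_card F t \<ge> 1" if "t \<in> {1..m}" for t
  proof -
    have "finite {i. (i, t) \<in> F}"
      by (rule finite_subset[of _ "{1..n}"]) (use ferrers_bounds[OF assms(1)] in auto)
    moreover have "1 \<in> {i. (i, t) \<in> F}" using ferrers_first_row[OF assms(1)] that by auto
    ultimately show ?thesis unfolding col_card_def
      by (metis One_nat_def Suc_leI card_gt_0_iff empty_iff)
  qed
  have colm: "col_card F m = n"
  proof -
    have "{i. (i, m) \<in> F} = {1..n}"
      unfolding ferrers_last_column[OF assms(1)] by auto
    then show ?thesis by (simp add: col_card_def)
  qed
  have cF: "int (card F) = (\<Sum>t = 1..m. int (col_card F t))"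
    by (simp add: card_eq_sum_col_card[OF assms(1)])
  \<comment> \<open>The range for \<open>j = 0\<close> ends at \<open>m - 1\<close>; the successor
    form splits off the last summand.\<close>
  obtain p where p: "m = Suc p" using assms(3) by (cases m) auto
  have k0: "kappa_j m F 2 0 = int (card F) - int n"
    using colm p assms(3) by (simp add: kappa_j_def cF numeral_2_eq_2)
  have "kappa_j m F 2 1 = (\<Sum>t = 1..m. int (col_card F t) - 1)"
    unfolding kappa_j_def
  proof (rule sum.cong)
    fix t assume "t \<in> {1..m}"
    then show "max (int (col_card F t) - int 1) 0 = int (col_card F t) - 1"
      using colpos[of t] by simp
  qed (use assms(3) in simp)
  then have k1: "kappa_j m F 2 1 = int (card F) - int m"
    by (simp add: cF sum_subtractf)
  have "{..<2::nat} = {0, 1}" by auto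
  then show ?thesis unfolding kappa_def using k0 k1 assms(2) by simp
qed

text \<open>A diagonal meeting \<open>F\<close> contributes its size minus 1, an empty one
  contributes 0. The diagonals met are counted through the indices \<open>m + a - b\<close> of the
  cells.\<close>

lemma diagonal_sum:
  assumes "ferrers_diagram n m F"
  shows "(\<Sum>i = 1..m + n - 1. max 0 (int (card (diagonal n m i \<inter> F)) - int 2 + 1))
           = int (card F) - int (card ((\<lambda>(a, b). m + a - b) ` F))"
proof -
  let ?D = "\<lambda>i. diagonal n m i \<inter> F" and ?I = "{1..m + n - 1}"
  let ?J = "(\<lambda>(a, b). m + a - b) ` F"
  \<comment> \<open>Natural subtraction is exact here, since \<open>b \<le> m\<close> for every cell
    of \<open>F\<close>.\<close>
  have D: "?D i = {p \<in> F. (case p of (a, b) \<Rightarrow> m + a - b) = i}" for i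
    by (auto simp: diagonal_def dest: ferrers_bounds[OF assms])
  have fin: "finite (?D i)" for i using ferrers_finite[OF assms] by simp
  have JI: "?J \<subseteq> ?I" using ferrers_bounds[OF assms] by fastforce
  have J: "i \<in> ?J \<longleftrightarrow> ?D i \<noteq> {}" for i unfolding D by auto
  have "F = (\<Union>i \<in> ?I. ?D i)" unfolding D using JI by auto
  then have "card F = card (\<Union>i \<in> ?I. ?D i)" by simp
  also have "\<dots> = (\<Sum>i \<in> ?I. card (?D i))"
    by (rule card_UN_disjoint) (use fin in \<open>auto simp: diagonal_def\<close>)
  finally have F: "int (card F) = (\<Sum>i \<in> ?I. int (card (?D i)))" by simp
  have "int (card ?J) = (\<Sum>i \<in> ?I. if i \<in> ?J then 1 else 0)"
    using JI by (simp add: sum.If_cases Int_absorb1)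
  also have "int (card F) - \<dots> = (\<Sum>i \<in> ?I. max 0 (int (card (?D i)) - int 2 + 1))"
    unfolding F sum_subtractf[symmetric]
  proof (rule sum.cong[OF refl])
    fix i
    have "i \<in> ?J \<longleftrightarrow> card (?D i) > 0" using J[of i] fin[of i] by (simp only: card_gt_0_iff) simp
    then show "int (card (?D i)) - (if i \<in> ?J then 1 else 0)
        = max 0 (int (card (?D i)) - int 2 + 1)" by auto
  qed
  finally show ?thesis by simp
qed

lemma MDS_constructible_two_iff:
  assumes "ferrers_diagram n m F" "n \<le> m" "2 \<le> m"
  shows "MDS_constructible n m F 2 \<longleftrightarrow> (\<forall>(a, b) \<in> F. a \<le> b)"
proof -
  let ?J = "(\<lambda>(a, b). m + a - b) ` F"
  have fin: "finite ?J" using ferrers_finite[OF assms(1)] by simp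
  have sub: "{1..m} \<subseteq> ?J"
  proof
    fix i assume "i \<in> {1..m}"
    \<comment> \<open>Diagonal \<open>i\<close> meets the first row in column
      \<open>m + 1 - i\<close>.\<close>
    then have "(1, m + 1 - i) \<in> F" "i = m + 1 - (m + 1 - i)"
      using ferrers_first_row[OF assms(1)] by auto
    then show "i \<in> ?J" by force
  qed
  have "MDS_constructible n m F 2 \<longleftrightarrow> card ?J = m"
    unfolding MDS_constructible_def kappa_two[OF assms] diagonal_sum[OF assms(1)] by auto
  also have "\<dots> \<longleftrightarrow> ?J = {1..m}"
    using card_subset_eq[OF fin sub] by auto
  also have "\<dots> \<longleftrightarrow> ?J \<subseteq> {1..m}" using sub by auto
  \<comment> \<open>A diagonal index \<open>m + a - b\<close> exceeds \<open>m\<close> exactly when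
    \<open>a > b\<close>.\<close>
  also have "\<dots> \<longleftrightarrow> (\<forall>(a, b) \<in> F. a \<le> b)"
    using ferrers_bounds[OF assms(1)] by fastforce
  finally show ?thesis .
qed

section \<open>Counting\<close>

lemma finite_upper_ferrers: "finite (upper_ferrers n m)"
  by (rule finite_subset[of _ "Pow ({1..n} \<times> {1..m})"])
    (auto simp: upper_ferrers_def ferrers_diagram_def)

text \<open>The corner \<open>(n, m)\<close> would itself lie below the diagonal.\<close>

lemma upper_ferrers_empty:
  assumes "m < n"
  shows "upper_ferrers n m = {}"
proof -
  have "(n, m) \<in> F" "\<forall>(a, b) \<in> F. a \<le> b" if "F \<in> upper_ferrers n m" for F
    using that by (simp_all add: upper_ferrers_def ferrers_diagram_def)
  then show ?thesis using assms by fastforce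
qed

lemma upper_ferrers_one_row:
  assumes "1 \<le> m"
  shows "upper_ferrers 1 m = {{1} \<times> {1..m}}"
proof
  show "upper_ferrers 1 m \<subseteq> {{1} \<times> {1..m}}"
    using ferrers_first_row[of 1 m] ferrers_bounds[of 1 m]
    by (fastforce simp: upper_ferrers_def)
  show "{{1} \<times> {1..m}} \<subseteq> upper_ferrers 1 m"
    using assms by (auto simp: upper_ferrers_def ferrers_diagram_def)
qed

text \<open>The two cases are disjoint images of injections: \<open>?f\<close> appends a full last
  column, \<open>?g\<close> adds a last row consisting of the corner. By \<open>n \<le> m\<close>
  the new cells stay weakly above the diagonal.\<close>

lemma card_upper_ferrers_rec:
  assumes "1 \<le> n" "n \<le> m"
  shows "card (upper_ferrers (Suc n) (Suc m))
           = card (upper_ferrers (Suc n) m) + card (upper_ferrers n (Suc m))"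
proof -
  let ?f = "\<lambda>F. F \<union> {1..Suc n} \<times> {Suc m}" and ?g = "insert (Suc n, Suc m)"
  let ?A = "upper_ferrers (Suc n) m" and ?B = "upper_ferrers n (Suc m)"
  have "inj_on ?f ?A"
  proof (rule inj_on_inverseI)
    fix F assume "F \<in> ?A"
    then show "?f F - {1..Suc n} \<times> {Suc m} = F"
      using ferrers_bounds[of "Suc n" m F] by (fastforce simp: upper_ferrers_def)
  qed
  then have cA: "card (?f ` ?A) = card ?A" by (rule card_image)
  have "inj_on ?g ?B"
  proof (rule inj_on_inverseI)
    fix F assume "F \<in> ?B"
    then show "?g F - {(Suc n, Suc m)} = F"
      using ferrers_bounds[of n "Suc m" F] by (fastforce simp: upper_ferrers_def)
  qed
  then have cB: "card (?g ` ?B) = card ?B" by (rule card_image)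
  have fA: "?f F \<in> upper_ferrers (Suc n) (Suc m) \<and> (Suc n, m) \<in> ?f F" if "F \<in> ?A" for F
  proof -
    have F: "ferrers_diagram (Suc n) m F" and up: "\<forall>(a, b) \<in> F. a \<le> b"
      using that by (auto simp: upper_ferrers_def)
    have mem: "(a, b) \<in> ?f F \<longleftrightarrow> (a, b) \<in> F \<or> 1 \<le> a \<and> a \<le> Suc n \<and> b = Suc m" for a b
      by auto
    have "ferrers_diagram (Suc n) (Suc m) (?f F)"
      unfolding ferrers_diagram_def mem
    proof (intro conjI allI impI)
      show "?f F \<subseteq> {1..Suc n} \<times> {1..Suc m}" using ferrers_bounds[OF F] by fastforce
      show "(1, 1) \<in> F \<or> 1 \<le> (1::nat) \<and> 1 \<le> Suc n \<and> 1 = Suc m"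
        using F by (simp add: ferrers_diagram_def)
      show "(Suc n, Suc m) \<in> F \<or> 1 \<le> Suc n \<and> Suc n \<le> Suc n \<and> Suc m = Suc m" by simp
    next
      fix i j assume "((i, j) \<in> F \<or> 1 \<le> i \<and> i \<le> Suc n \<and> j = Suc m) \<and> j < Suc m"
      then have ij: "(i, j) \<in> F" by auto
      show "(i, j + 1) \<in> F \<or> 1 \<le> i \<and> i \<le> Suc n \<and> j + 1 = Suc m"
        using ferrers_right[OF F ij, of "j + 1"] ferrers_bounds[OF F ij] by (cases "j = m") auto
    next
      fix i j assume "((i, j) \<in> F \<or> 1 \<le> i \<and> i \<le> Suc n \<and> j = Suc m) \<and> 1 < i"
      then show "(i - 1, j) \<in> F \<or> 1 \<le> i - 1 \<and> i - 1 \<le> Suc n \<and> j = Suc m"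
        using ferrers_up[OF F, of i j "i - 1"] by (cases i) auto
    qed
    moreover have "(Suc n, m) \<in> F" using F by (simp add: ferrers_diagram_def)
    ultimately show ?thesis using up assms by (auto simp: upper_ferrers_def)
  qed
  have gB: "?g F \<in> upper_ferrers (Suc n) (Suc m) \<and> (Suc n, m) \<notin> ?g F" if "F \<in> ?B" for F
  proof -
    have F: "ferrers_diagram n (Suc m) F" and up: "\<forall>(a, b) \<in> F. a \<le> b"
      using that by (auto simp: upper_ferrers_def)
    have mem: "(a, b) \<in> ?g F \<longleftrightarrow> (a, b) \<in> F \<or> a = Suc n \<and> b = Suc m" for a b
      by auto
    have "ferrers_diagram (Suc n) (Suc m) (?g F)"
      unfolding ferrers_diagram_def mem
    proof (intro conjI allI impI)
      show "?g F \<subseteq> {1..Suc n} \<times> {1..Suc m}" using ferrers_bounds[OF F] by fastforce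
      show "(1, 1) \<in> F \<or> 1 = Suc n \<and> 1 = Suc m"
        using F by (simp add: ferrers_diagram_def)
      show "(Suc n, Suc m) \<in> F \<or> Suc n = Suc n \<and> Suc m = Suc m" by simp
    next
      fix i j assume "((i, j) \<in> F \<or> i = Suc n \<and> j = Suc m) \<and> j < Suc m"
      then show "(i, j + 1) \<in> F \<or> i = Suc n \<and> j + 1 = Suc m"
        using ferrers_right[OF F, of i j "j + 1"] by auto
    next
      fix i j assume "((i, j) \<in> F \<or> i = Suc n \<and> j = Suc m) \<and> 1 < i"
      \<comment> \<open>Moving up from the new corner leads to \<open>(n, Suc m)\<close>, which is
        in \<open>F\<close> because its last column is full.\<close>
      then show "(i - 1, j) \<in> F \<or> i - 1 = Suc n \<and> j = Suc m"
        using ferrers_up[OF F, of i j "i - 1"] ferrers_last_column[OF F, of n] assms by (cases i) auto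
    qed
    then show ?thesis using up assms ferrers_bounds(2)[OF F] by (fastforce simp: upper_ferrers_def)
  qed
  have "upper_ferrers (Suc n) (Suc m) \<subseteq> ?f ` ?A \<union> ?g ` ?B"
  proof
    fix F assume "F \<in> upper_ferrers (Suc n) (Suc m)"
    then have F: "ferrers_diagram (Suc n) (Suc m) F" and up: "\<forall>(a, b) \<in> F. a \<le> b"
      by (auto simp: upper_ferrers_def)
    note bounds = ferrers_bounds[OF F] and last_col = ferrers_last_column[OF F]
    show "F \<in> ?f ` ?A \<union> ?g ` ?B"
    proof (cases "(Suc n, m) \<in> F")
      case True
      let ?G = "F - {1..Suc n} \<times> {Suc m}"
      have mem: "(a, b) \<in> ?G \<longleftrightarrow> (a, b) \<in> F \<and> b \<le> m" for a b
        using bounds[of a b] by (auto simp: le_Suc_eq)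
      have "ferrers_diagram (Suc n) m ?G"
        unfolding ferrers_diagram_def mem
      proof (intro conjI allI impI)
        show "?G \<subseteq> {1..Suc n} \<times> {1..m}"
        proof (rule subrelI)
          fix a b assume "(a, b) \<in> ?G"
          then have "(a, b) \<in> F" "b \<le> m" using mem by blast+
          then show "(a, b) \<in> {1..Suc n} \<times> {1..m}" using bounds[of a b] by simp
        qed
        show "(1, 1) \<in> F" using F by (simp add: ferrers_diagram_def)
        show "1 \<le> m" "m \<le> m" using assms by auto
        show "(Suc n, m) \<in> F" by (rule True)
      next
        fix i j assume "((i, j) \<in> F \<and> j \<le> m) \<and> j < m"
        then show "(i, j + 1) \<in> F" "j + 1 \<le> m" using ferrers_right[OF F, of i j "j + 1"] by auto
      next
        fix i j assume "((i, j) \<in> F \<and> j \<le> m) \<and> 1 < i"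
        then show "(i - 1, j) \<in> F" "j \<le> m" using ferrers_up[OF F, of i j "i - 1"] by auto
      qed
      then have "?G \<in> ?A" using up by (auto simp: upper_ferrers_def)
      \<comment> \<open>The last column of \<open>F\<close> is full, so restoring it recovers
        \<open>F\<close> from \<open>?G\<close>.\<close>
      moreover have "{1..Suc n} \<times> {Suc m} \<subseteq> F"
        by (rule subrelI) (simp add: last_col del: One_nat_def)
      then have "F = ?f ?G" by blast
      ultimately show ?thesis by blast
    next
      case False
      let ?G = "F - {(Suc n, Suc m)}"
      \<comment> \<open>Any earlier cell of the last row would force \<open>(Suc n, m)\<close> into
        \<open>F\<close> by closure to the right.\<close>
      have row: "b = Suc m" if "(Suc n, b) \<in> F" for b
        using ferrers_right[OF F that, of m] bounds[OF that] False by (auto simp: le_Suc_eq)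
      have mem: "(a, b) \<in> ?G \<longleftrightarrow> (a, b) \<in> F \<and> a \<le> n" for a b
        using row bounds[of a b] by (auto simp: le_Suc_eq)
      have "ferrers_diagram n (Suc m) ?G"
        unfolding ferrers_diagram_def mem
      proof (intro conjI allI impI)
        show "?G \<subseteq> {1..n} \<times> {1..Suc m}"
        proof (rule subrelI)
          fix a b assume "(a, b) \<in> ?G"
          then have "(a, b) \<in> F" "a \<le> n" using mem by blast+
          then show "(a, b) \<in> {1..n} \<times> {1..Suc m}" using bounds[of a b] by simp
        qed
        show "(1, 1) \<in> F" using F by (simp add: ferrers_diagram_def)
        show "1 \<le> n" "n \<le> n" using assms by auto
        show "(n, Suc m) \<in> F" using last_col assms by simp
      next
        fix i j assume "((i, j) \<in> F \<and> i \<le> n) \<and> j < Suc m"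
        then show "(i, j + 1) \<in> F" "i \<le> n" using ferrers_right[OF F, of i j "j + 1"] by auto
      next
        fix i j assume "((i, j) \<in> F \<and> i \<le> n) \<and> 1 < i"
        then show "(i - 1, j) \<in> F" "i - 1 \<le> n" using ferrers_up[OF F, of i j "i - 1"] by auto
      qed
      then have "?G \<in> ?B" using up by (auto simp: upper_ferrers_def)
      moreover have "(Suc n, Suc m) \<in> F" by (simp add: last_col)
      then have "F = ?g ?G" by blast
      ultimately show ?thesis by blast
    qed
  qed
  then have "upper_ferrers (Suc n) (Suc m) = ?f ` ?A \<union> ?g ` ?B" using fA gB by blast
  moreover have "?f ` ?A \<inter> ?g ` ?B = {}" using fA gB by blast
  ultimately show ?thesis
    by (simp only: card_Un_disjoint finite_imageI finite_upper_ferrers cA cB)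
qed

section \<open>Solving the recurrence\<close>

text \<open>With \<open>n = k + 2\<close> and \<open>m = p + 1\<close> this is the ballot number as
  a difference of adjacent binomials, written additively to avoid natural subtraction. Pascal's rule
  turns the recurrence into the induction step.\<close>

lemma card_upper_ferrers_binomial:
  assumes "k \<le> p"
  shows "card (upper_ferrers (Suc (Suc k)) (Suc p)) + ((p + k + 1) choose k) = (p + k + 1) choose (Suc k)"
  using assms
proof (induction "p + k" arbitrary: p k rule: less_induct)
  case less
  show ?case
  proof (cases "k = p")
    case True
    \<comment> \<open>Here \<open>m = n - 1\<close>: there are no diagrams, and the two central
      binomials agree by symmetry.\<close>
    then show ?thesis
      using binomial_symmetric[of k "2 * k + 1"] by (simp add: upper_ferrers_empty mult_2)
  next
    case False
    then obtain q where p: "p = Suc q" and "k \<le> q" using less.prems by (cases p) auto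
    then have IH1: "card (upper_ferrers (Suc (Suc k)) p) + ((q + k + 1) choose k)
        = (q + k + 1) choose (Suc k)"
      using less.hyps[of q k] by simp
    have rec: "card (upper_ferrers (Suc (Suc k)) (Suc p))
        = card (upper_ferrers (Suc (Suc k)) p) + card (upper_ferrers (Suc k) (Suc p))"
      using card_upper_ferrers_rec[of "Suc k" p] p \<open>k \<le> q\<close> by simp
    show ?thesis
    proof (cases k)
      case 0
      \<comment> \<open>The second summand counts diagrams with a single row, of which there is
        one.\<close>
      then show ?thesis using rec IH1 upper_ferrers_one_row[of "Suc p"] by (simp add: p)
    next
      case (Suc j)
      then have "card (upper_ferrers (Suc k) (Suc p)) + ((p + j + 1) choose j)
          = (p + j + 1) choose (Suc j)"
        using less.hyps[of p j] less.prems by simp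
      then show ?thesis using rec IH1 by (simp add: p Suc)
    qed
  qed
qed

text \<open>Adjacent binomials have the ratio \<open>(p + 1) / (k + 1)\<close>, so their difference
  is \<open>(p - k) / (p + 1)\<close> times the larger one, and
  \<open>p - k = m - n + 1\<close>.\<close>

lemma card_upper_ferrers:
  assumes "2 \<le> n" "n \<le> m"
  shows "real (card (upper_ferrers n m))
           = (real m - real n + 1) / real m * real ((m + n - 2) choose (n - 1))"
proof -
  obtain k where n: "n = Suc (Suc k)" using assms(1) by (metis add_2_eq_Suc le_Suc_ex)
  obtain p where m: "m = Suc p" using assms by (cases m) auto
  have "k \<le> p" using assms n m by simp
  let ?N = "p + k + 1"
  \<comment> \<open>Both sides equal \<open>?N * ((?N - 1) choose k)\<close> by absorption.\<close>
  have "Suc k * (?N choose Suc k) = Suc p * (?N choose k)"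
  proof -
    have "?N - k = Suc p" by simp
    then show ?thesis
      using binomial_absorb_comp[of ?N k] binomial_absorption[of k ?N] by metis
  qed
  then have "real (Suc k) * real (?N choose Suc k) = real (Suc p) * real (?N choose k)"
    by (metis of_nat_mult)
  moreover have "real (card (upper_ferrers n m)) = real (?N choose Suc k) - real (?N choose k)"
    using card_upper_ferrers_binomial[OF \<open>k \<le> p\<close>] unfolding n m by linarith
  moreover have "c = (real (Suc p) - real (Suc (Suc k)) + 1) / real (Suc p) * x"
    if "real (Suc k) * x = real (Suc p) * y" "c = x - y" for c x y
  proof -
    have "real (Suc p) * c = (real p - real k) * x"
      unfolding that(2) using that(1) by (simp add: algebra_simps)
    then show ?thesis by (simp add: field_simps)
  qed
  ultimately show ?thesis by (simp only: n m diff_Suc_1) simp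
qed

lemma MDS_constructible_two_set:
  assumes "2 \<le> n" "n \<le> m"
  shows "{F. ferrers_diagram n m F \<and> MDS_constructible n m F 2} = upper_ferrers n m"
  using MDS_constructible_two_iff[of n m] assms by (auto simp: upper_ferrers_def)

theorem theorem5p7:
  fixes n m :: nat
  assumes "n \<ge> 2" and "m \<ge> n"
  shows "real (card {F. ferrers_diagram n m F \<and> MDS_constructible n m F 2})
           = (real m - real n + 1) / real m * real ((m + n - 2) choose (n - 1))
         \<and> real (card {F. ferrers_diagram n n F \<and> MDS_constructible n n F 2}) = catalan (n - 1)
         \<and> catalan (n - 1) = 1 / real n * real ((2 * n - 2) choose (n - 1))"
proof -
  have "catalan (n - 1) = 1 / real n * real ((2 * n - 2) choose (n - 1))"
    using assms(1) by (simp add: catalan_def diff_mult_distrib2)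
  moreover have "n + n - 2 = 2 * n - 2" by simp
  \<comment> \<open>For \<open>m = n\<close> the ballot factor becomes \<open>1 / n\<close>, which
    gives the Catalan number.\<close>
  ultimately show ?thesis
    using card_upper_ferrers[of n m] card_upper_ferrers[of n n] assms
    by (simp add: MDS_constructible_two_set)
qed

end
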